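(* Let $m\ge 2$, $s\ge 1$ and let $X_1,\dots,X_m\in\mathbb{Z}^s$ span $\mathbb{R}^s$ and satisfy $\langle X_j,\alpha\rangle>0$ for all $j$, for some $\alpha\in\mathbb{R}^s$. Let $\mathcal{J}=X_1\mathbb{N}+\dots+X_m\mathbb{N}$ and for $z\in\mathcal{J}$ let $A(z)=\{u\in\mathbb{N}^m:\sum_{j=1}^mu_jX_j=z\}\subset\mathbb{R}^m$. Let $C_0\ge1$ be an integer. Then there exists an integer $M>0$ such that $d_H(A(z),A(z'))<M$ whenever $z,z'\in\mathcal{J}$ and $\|z-z'\|\le C_0$.
   Context: $\mathbb{N}=\{0,1,2,\dots\}$, $\|\cdot\|$ is the Euclidean norm, and $d_H(A,B)=\max\{\sup_{a\in A}d(a,B),\sup_{b\in B}d(b,A)\}$ is the Hausdorff distance with respect to the Euclidean metric. *)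

theory Defs
  imports "HOL-Analysis.Analysis"
begin

text \<open>
  The suprema are taken in \<^typ>\<open>ereal\<close>, so that the distance is \<open>\<infinity>\<close> rather than an unspecified
  real if they are unbounded. \<^const>\<open>infdist\<close> to the empty set is \<open>0\<close>, so the definition is
  meaningful for nonempty sets only.
\<close>

definition hausdorff_dist :: "'a::metric_space set \<Rightarrow> 'a set \<Rightarrow> ereal" where
  "hausdorff_dist A B =
     max (SUP a\<in>A. ereal (infdist a B)) (SUP b\<in>B. ereal (infdist b A))"

definition nat_cone :: "('m::finite \<Rightarrow> real ^ 's) \<Rightarrow> (real ^ 's) set" where
  "nat_cone X = {\<Sum>j\<in>UNIV. real (k j) *\<^sub>R X j | k :: 'm \<Rightarrow> nat. True}"

definition nat_fiber :: "('m::finite \<Rightarrow> real ^ 's) \<Rightarrow> real ^ 's \<Rightarrow> (real ^ 'm) set" where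
  "nat_fiber X z = {u. (\<forall>j. u $ j \<in> \<nat>) \<and> (\<Sum>j\<in>UNIV. (u $ j) *\<^sub>R X j) = z}"

end

theory Submission
  imports Defs
begin

text \<open>
  Pairs \<open>(u, v)\<close> of natural vectors whose images differ by a fixed \<open>w\<close> have, by Dickson's lemma,
  finitely many componentwise minimal elements \<open>(p, q)\<close>. If \<open>(p, q) \<le> (u, v)\<close>, then \<open>u - p\<close> and
  \<open>v - q\<close> have the same image, so \<open>q + (u - p)\<close> lies in the fiber of \<open>v\<close>, and its distance from
  \<open>u\<close> is \<open>norm (p - q)\<close>. Only finitely many integral \<open>w\<close> have norm at most \<open>C\<^sub>0\<close>.
\<close>

text \<open>Every sequence has a monotone subsequence. If it decreases, it attains its least value
  and is constant from there on, so a tail of it is increasing.\<close>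

lemma nat_seq_incseq_subseq:
  fixes f :: "nat \<Rightarrow> nat"
  obtains r where "strict_mono r" "incseq (f \<circ> r)"
proof -
  obtain r where r: "strict_mono r" "monoseq (\<lambda>n. f (r n))"
    using seq_monosub[of f] by auto
  show thesis
  proof (cases "incseq (\<lambda>n. f (r n))")
    case True
    with r that show thesis by (auto simp: comp_def)
  next
    case False
    then have dec: "decseq (\<lambda>n. f (r n))"
      using r(2) by (simp add: monoseq_iff)
    obtain N where N: "\<And>n. f (r N) \<le> f (r n)"
      using ex_has_least_nat[of "\<lambda>_. True" 0 "\<lambda>n. f (r n)"] by auto
    have const: "f (r (n + N)) = f (r N)" for n
      using N[of "n + N"] decseqD[OF dec, of N "n + N"] by simp
    have "strict_mono (\<lambda>n. r (n + N))"
      using r(1) by (simp add: strict_mono_def)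
    moreover have "incseq (f \<circ> (\<lambda>n. r (n + N)))"
      by (simp add: comp_def const incseq_def)
    ultimately show thesis by (rule that)
  qed
qed

text \<open>The coordinates are treated one at a time: passing to a further subsequence keeps the
  monotonicity already obtained.\<close>

lemma fun_seq_incseq_subseq:
  fixes f :: "nat \<Rightarrow> 'a \<Rightarrow> nat"
  assumes "finite A"
  shows "\<exists>r. strict_mono r \<and> (\<forall>a\<in>A. incseq (\<lambda>n. f (r n) a))"
  using assms
proof (induction A rule: finite_induct)
  case empty
  show ?case by (auto intro: strict_mono_id)
next
  case (insert a A)
  then obtain r where r: "strict_mono r" "\<forall>b\<in>A. incseq (\<lambda>n. f (r n) b)"
    by blast
  obtain s where s: "strict_mono s" "incseq ((\<lambda>n. f (r n) a) \<circ> s)"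
    by (rule nat_seq_incseq_subseq)
  have "incseq (\<lambda>n. f (r (s n)) b)" if "b \<in> A" for b
    using r(2) that strict_mono_mono[OF s(1)] by (auto simp: mono_def)
  with s(2) have "\<forall>b\<in>insert a A. incseq (\<lambda>n. f ((r \<circ> s) n) b)"
    by (auto simp: comp_def)
  with strict_mono_o[OF r(1) s(1)] show ?case by blast
qed

text \<open>The minimal elements of \<open>S\<close> serve as \<open>F\<close>. They form an
  antichain, whereas an injective sequence of them would have two comparable terms, because some
  subsequence increases in every coordinate.\<close>

lemma Dickson_finite_basis:
  fixes S :: "('a::finite \<Rightarrow> nat) set"
  obtains F where "finite F" "F \<subseteq> S" "\<And>s. s \<in> S \<Longrightarrow> \<exists>f\<in>F. f \<le> s"
proof
  let ?F = "{f\<in>S. \<forall>g\<in>S. g \<le> f \<longrightarrow> g = f}"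
  show "?F \<subseteq> S" by blast
  show "finite ?F"
  proof (rule ccontr)
    assume "infinite ?F"
    then obtain f :: "nat \<Rightarrow> 'a \<Rightarrow> nat" where f: "inj f" "range f \<subseteq> ?F"
      using infinite_countable_subset by blast
    obtain r where r: "strict_mono r" "\<forall>a\<in>UNIV. incseq (\<lambda>n. f (r n) a)"
      using fun_seq_incseq_subseq[of UNIV f] by auto
    have "f (r 0) \<le> f (r 1)"
      using r(2) by (auto simp: le_fun_def incseq_def)
    then have "f (r 0) = f (r 1)" using f(2) by blast
    then have "r 0 = r 1" using f(1) by (simp add: inj_eq)
    then show False using r(1) by (simp add: strict_mono_eq)
  qed
  show "\<exists>f\<in>?F. f \<le> s" if "s \<in> S" for s
  proof -
    \<comment> \<open>The coordinate sum is strictly monotone, so an element of \<open>S\<close>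
      below \<open>s\<close> with least sum is minimal in all of \<open>S\<close>.\<close>
    let ?\<mu> = "\<lambda>f. \<Sum>a\<in>UNIV. f a"
    obtain f where f: "f \<in> S" "f \<le> s"
      and least: "\<And>g. g \<in> S \<Longrightarrow> g \<le> s \<Longrightarrow> ?\<mu> f \<le> ?\<mu> g"
      using ex_has_least_nat[of "\<lambda>f. f \<in> S \<and> f \<le> s" s ?\<mu>] \<open>s \<in> S\<close> by auto
    have "g = f" if g: "g \<in> S" "g \<le> f" for g
    proof (rule ccontr)
      assume "g \<noteq> f"
      then obtain a where "g a \<noteq> f a" by blast
      then have "g a < f a" using g(2) by (simp add: le_fun_def le_neq_implies_less)
      then have "?\<mu> g < ?\<mu> f"
        using g(2) by (intro sum_strict_mono_ex1) (auto simp: le_fun_def)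
      then show False
        using least[OF g(1)] g(2) f(2) by (meson leD order_trans)
    qed
    with f show ?thesis by blast
  qed
qed

lemma nat_fiber_nonempty:
  fixes X :: "'m::finite \<Rightarrow> real ^ 's"
  assumes "z \<in> nat_cone X"
  shows "nat_fiber X z \<noteq> {}"
proof -
  obtain k :: "'m \<Rightarrow> nat" where "z = (\<Sum>j\<in>UNIV. real (k j) *\<^sub>R X j)"
    using assms by (auto simp: nat_cone_def)
  then have "(\<chi> j. real (k j)) \<in> nat_fiber X z" by (simp add: nat_fiber_def)
  then show ?thesis by blast
qed

lemma nat_fiberE:
  assumes "u \<in> nat_fiber X z"
  obtains k where "u = (\<chi> j. real (k j))" "(\<Sum>j\<in>UNIV. real (k j) *\<^sub>R X j) = z"
proof -
  have "\<forall>j. \<exists>n. u $ j = real n" using assms by (auto simp: nat_fiber_def Nats_def)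
  then obtain k where k: "\<And>j. u $ j = real (k j)" by metis
  show thesis
    using assms k by (intro that[of k]) (auto simp: nat_fiber_def vec_eq_iff)
qed

lemma infdist_nat_fiber_bounded:
  fixes X :: "'m::finite \<Rightarrow> real ^ 's::finite"
  shows "\<exists>K. \<forall>z z' u. z - z' = w \<longrightarrow> nat_fiber X z' \<noteq> {} \<longrightarrow> u \<in> nat_fiber X z \<longrightarrow>
    infdist u (nat_fiber X z') \<le> K"
proof -
  let ?L = "\<lambda>k::'m \<Rightarrow> nat. \<Sum>j\<in>UNIV. real (k j) *\<^sub>R X j"
  let ?d = "\<lambda>f::'m + 'm \<Rightarrow> nat. norm ((\<chi> j. real (f (Inl j)) - real (f (Inr j))) :: real ^ 'm)"
  \<comment> \<open>A pair of vectors is encoded as one function on \<open>'m + 'm\<close>, with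
    \<open>Inl\<close> for the first and \<open>Inr\<close> for the second, so that a single use of
    Dickson's lemma covers both.\<close>
  obtain F where F: "finite F" "F \<subseteq> {f. ?L (f \<circ> Inl) - ?L (f \<circ> Inr) = w}"
    and basis: "\<And>s. s \<in> {f. ?L (f \<circ> Inl) - ?L (f \<circ> Inr) = w} \<Longrightarrow> \<exists>f\<in>F. f \<le> s"
    using Dickson_finite_basis[of "{f. ?L (f \<circ> Inl) - ?L (f \<circ> Inr) = w}"] by blast
  obtain K where K: "\<And>f. f \<in> F \<Longrightarrow> ?d f \<le> K"
    using F(1) bdd_above_finite[of "?d ` F"] by (auto simp: bdd_above_def)
  have "infdist u (nat_fiber X z') \<le> K"
    if w: "z - z' = w" and ne: "nat_fiber X z' \<noteq> {}" and u: "u \<in> nat_fiber X z" for z z' u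
  proof -
    obtain a where a: "u = (\<chi> j. real (a j))" "?L a = z"
      using u by (rule nat_fiberE)
    obtain b where b: "?L b = z'"
      using ne by (auto elim: nat_fiberE)
    obtain f where f: "f \<in> F" "f \<le> case_sum a b"
      using basis[of "case_sum a b"] a b w by (auto simp: comp_def)
    have le: "f (Inl j) \<le> a j" for j
      using f(2) by (metis le_funD sum.case(1))
    \<comment> \<open>The subtraction on naturals is not truncated, thanks to \<open>le\<close>;
      hence the real identity \<open>v\<close>.\<close>
    let ?v = "\<lambda>j. f (Inr j) + (a j - f (Inl j))"
    have v: "real (?v j) = real (f (Inr j)) + (real (a j) - real (f (Inl j)))" for j
      using le[of j] by (simp only: of_nat_add of_nat_diff)
    have "?L ?v = ?L (f \<circ> Inr) + (?L a - ?L (f \<circ> Inl))"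
      unfolding v by (simp add: scaleR_left.add scaleR_left.diff sum.distrib sum_subtractf)
    \<comment> \<open>Membership of \<open>f\<close> in \<open>F\<close> makes the two images of
      \<open>f\<close> differ by \<open>w\<close>, so the sum equals \<open>z - w\<close>.\<close>
    also have "\<dots> = z'"
      using F(2) f(1) a(2) w by (auto simp: algebra_simps)
    finally have "(\<chi> j. real (?v j)) \<in> nat_fiber X z'"
      by (auto simp: nat_fiber_def simp del: of_nat_add)
    then have "infdist u (nat_fiber X z') \<le> dist u (\<chi> j. real (?v j))"
      by (rule infdist_le)
    also have "u - (\<chi> j. real (?v j)) = (\<chi> j. real (f (Inl j)) - real (f (Inr j)))"
      unfolding v by (simp add: a(1) vec_eq_iff)
    then have "dist u (\<chi> j. real (?v j)) = ?d f"
      by (simp add: dist_norm)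
    also have "\<dots> \<le> K" by (rule K[OF f(1)])
    finally show ?thesis .
  qed
  then show ?thesis by blast
qed

text \<open>Each coordinate is bounded by the norm and so takes only finitely many integer
  values.\<close>

lemma finite_bounded_integral_vectors:
  "finite {w :: real ^ 's::finite. (\<forall>i. w $ i \<in> \<int>) \<and> norm w \<le> C}"
proof (rule finite_subset)
  let ?I = "{x::real. x \<in> \<int> \<and> \<bar>x\<bar> \<le> C}"
  show "{w :: real ^ 's. (\<forall>i. w $ i \<in> \<int>) \<and> norm w \<le> C} \<subseteq> vec_lambda ` (UNIV \<rightarrow>\<^sub>E ?I)"
  proof
    fix w :: "real ^ 's" assume "w \<in> {w. (\<forall>i. w $ i \<in> \<int>) \<and> norm w \<le> C}"
    then have "vec_nth w \<in> UNIV \<rightarrow>\<^sub>E ?I"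
      using order_trans[OF component_le_norm_cart[of w]] by (auto simp: PiE_def Pi_def)
    then show "w \<in> vec_lambda ` (UNIV \<rightarrow>\<^sub>E ?I)"
      by (metis image_eqI vec_nth_inverse)
  qed
  show "finite (vec_lambda ` (UNIV \<rightarrow>\<^sub>E ?I) :: (real ^ 's) set)"
    by (intro finite_imageI finite_PiE finite_abs_int_segment finite_class.finite_UNIV)
qed

lemma nat_cone_integral:
  assumes "\<And>j i. X j $ i \<in> \<int>" and "z \<in> nat_cone X"
  shows "z $ i \<in> \<int>"
  using assms by (auto simp: nat_cone_def intro!: Ints_sum Ints_mult)

theorem theorem3p2:
  fixes X :: "'m::finite \<Rightarrow> real ^ 's::finite" and C\<^sub>0 :: int
  assumes "CARD('m) \<ge> 2"
    and "\<And>j i. X j $ i \<in> \<int>"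
    and "span (range X) = UNIV"
    and "\<exists>\<alpha>. \<forall>j. X j \<bullet> \<alpha> > 0"
    and "C\<^sub>0 \<ge> 1"
  shows "\<exists>M::int. M > 0 \<and>
    (\<forall>z\<in>nat_cone X. \<forall>z'\<in>nat_cone X. norm (z - z') \<le> of_int C\<^sub>0 \<longrightarrow>
       hausdorff_dist (nat_fiber X z) (nat_fiber X z') < ereal (of_int M))"
proof -
  let ?W = "{w :: real ^ 's. (\<forall>i. w $ i \<in> \<int>) \<and> norm w \<le> of_int C\<^sub>0}"
  have "\<forall>w. \<exists>K. \<forall>z z' u. z - z' = w \<longrightarrow> nat_fiber X z' \<noteq> {} \<longrightarrow> u \<in> nat_fiber X z \<longrightarrow>
      infdist u (nat_fiber X z') \<le> K"
    using infdist_nat_fiber_bounded by (rule allI)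
  from choice[OF this] obtain K where K: "\<And>z z' u. nat_fiber X z' \<noteq> {} \<Longrightarrow>
      u \<in> nat_fiber X z \<Longrightarrow> infdist u (nat_fiber X z') \<le> K (z - z')"
    by blast
  \<comment> \<open>The bound \<open>K\<close> depends on the difference \<open>w\<close> alone, and
    \<open>?W\<close> is finite, so one \<open>B\<close> serves all pairs.\<close>
  obtain B where B: "\<And>w. w \<in> ?W \<Longrightarrow> K w \<le> B"
    using bdd_above_finite[OF finite_imageI[OF finite_bounded_integral_vectors], of K "of_int C\<^sub>0"]
    by (auto simp: bdd_above_def)
  \<comment> \<open>The suprema are only known to be at most \<open>B\<close>, so \<open>M\<close>
    must exceed \<open>B\<close> strictly; the maximum with 1 gives positivity whatever the sign of
    \<open>B\<close>.\<close>
  define M where "M = max 1 (\<lfloor>B\<rfloor> + 1)"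
  have "B < of_int M" unfolding M_def by linarith
  have le: "(SUP u\<in>nat_fiber X z. ereal (infdist u (nat_fiber X z'))) \<le> ereal B"
    if "z \<in> nat_cone X" "z' \<in> nat_cone X" "norm (z - z') \<le> of_int C\<^sub>0" for z z'
  proof (rule SUP_least)
    fix u assume u: "u \<in> nat_fiber X z"
    have "z - z' \<in> ?W"
      using that nat_cone_integral[of X, OF assms(2)] by auto
    from order_trans[OF K[OF nat_fiber_nonempty[OF that(2)] u] B[OF this]]
    show "ereal (infdist u (nat_fiber X z')) \<le> ereal B" by simp
  qed
  have "hausdorff_dist (nat_fiber X z) (nat_fiber X z') < ereal (of_int M)"
    if "z \<in> nat_cone X" "z' \<in> nat_cone X" "norm (z - z') \<le> of_int C\<^sub>0" for z z'
  proof -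
    have "hausdorff_dist (nat_fiber X z) (nat_fiber X z') \<le> ereal B"
      unfolding hausdorff_dist_def
      \<comment> \<open>The one-sided bound is applied in both directions, as the condition on
        \<open>z - z'\<close> is symmetric.\<close>
      using le[OF that] le[of z' z] that by (simp add: norm_minus_commute)
    also have "\<dots> < ereal (of_int M)" using \<open>B < of_int M\<close> by simp
    finally show ?thesis .
  qed
  moreover have "M > 0" by (simp add: M_def)
  ultimately show ?thesis by blast
qed

end
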